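(* For all integers $n \ge 0$ and $0 \le k \le n$: (a) $V^n_k$ is a $P_n$-module (i.e. a $P_n$-invariant subspace of the $P_n$-module $V^n$), and the modules $V^n_k$ are non-isomorphic for different $k$ (i.e. for $0\le k\neq k'\le n$, $V^n_k\not\cong V^n_{k'}$ as $P_n$-modules). (b) $V^n_k$ is irreducible (it contains no proper, nonzero $P_n$-invariant subspaces). (c) As a $P_n$-module, $V^n$ decomposes as $$V^n \cong \bigoplus_{k=0}^n V^n_k,$$ where each irreducible $P_n$-module appears with multiplicity $1$ (that is, every irreducible $P_n$-module is isomorphic to exactly one of the summands $V^n_k$, $0\le k\le n$).
   Context: A rook diagram on $n$ is a graph on two rows of $n$ vertices, each row labeled $1,\dots,n$ from left to right, in which every edge joins a top vertex to a bottom vertex and each vertex lies on at most one edge. It corresponds to the $n\times n$ $0$-$1$ matrix having a $1$ in position $(i,j)$ exactly when top vertex $i$ is joined to bottom vertex $j$ (so at most one $1$ in each row and each column). The product $d_1d_2$ is the matrix product; equivalently, place $d_1$ above $d_2$, identify the bottom row of $d_1$ with the top row of $d_2$, and keep the edges obtained by composition. A rook diagram is planar if it can be drawn inside the rectangle formed by its vertices without edge crossings. $P_n$ denotes the monoid of planar rook diagrams on $n$ (the planar rook monoid), with $P_0=\{\emptyset\}$ the one-element monoid; its identity is the diagram with edges joining top $i$ to bottom $i$ for all $i$. For $d\in P_n$, $\tau(d)$ and $\beta(d)$ are the sets of vertices in the top and bottom rows, respectively, that are incident to an edge. View $d$ as the bijection $\beta(d)\to\tau(d)$ sending each bottom vertex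 to the top vertex it is joined to (planarity means this bijection is order-preserving). For $S\subseteq\beta(d)$ put $d(S)=\{d(s): s\in S\}$. $V^n$ is the complex vector space with basis $\{v_S : S\subseteq\{1,\dots,n\}\}$, on which $d\in P_n$ acts linearly by $d v_S = v_{d(S)}$ if $S\subseteq\beta(d)$ and $d v_S=0$ otherwise. $V^n_k$ is the span of the $v_S$ with $|S|=k$. A $P_n$-module is a complex vector space with a linear action of the monoid $P_n$ in which the identity acts as the identity map; it is irreducible if it is nonzero and has no proper nonzero $P_n$-invariant subspace. *)

theory Defs
  imports Complex_Main "HOL-Library.Function_Algebras" "HOL-Algebra.Group"
begin

section \<open>Modules over a monoid\<close>

text \<open>
  A complex vector space with a linear action of a monoid. The underlying space is a subspace
  \<open>vspace\<close> of an ambient type, so that submodules are again modules; the action matters on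
  \<open>vspace\<close> only.
\<close>

record ('m, 'v) monoid_rep =
  vspace :: "'v set"
  smul :: "complex \<Rightarrow> 'v \<Rightarrow> 'v"
  act :: "'m \<Rightarrow> 'v \<Rightarrow> 'v"

locale monoid_module = monoid G + vector_space "smul M"
  for G (structure) and M :: "('m, 'v::ab_group_add) monoid_rep" +
  assumes subspace_vspace: "subspace (vspace M)"
    and act_closed: "\<lbrakk>d \<in> carrier G; x \<in> vspace M\<rbrakk> \<Longrightarrow> act M d x \<in> vspace M"
    and act_add: "\<lbrakk>d \<in> carrier G; x \<in> vspace M; y \<in> vspace M\<rbrakk>
      \<Longrightarrow> act M d (x + y) = act M d x + act M d y"
    and act_smul: "\<lbrakk>d \<in> carrier G; x \<in> vspace M\<rbrakk>
      \<Longrightarrow> act M d (smul M c x) = smul M c (act M d x)"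
    and act_mult: "\<lbrakk>d \<in> carrier G; e \<in> carrier G; x \<in> vspace M\<rbrakk>
      \<Longrightarrow> act M (d \<otimes> e) x = act M d (act M e x)"
    and act_one: "x \<in> vspace M \<Longrightarrow> act M \<one> x = x"

definition invariant_subspace ::
    "('m, 'g) monoid_scheme \<Rightarrow> ('m, 'v::ab_group_add) monoid_rep \<Rightarrow> 'v set \<Rightarrow> bool" where
  "invariant_subspace G M U \<longleftrightarrow>
     U \<subseteq> vspace M \<and> module.subspace (smul M) U \<and>
     (\<forall>d\<in>carrier G. \<forall>x\<in>U. act M d x \<in> U)"

definition irreducible_module ::
    "('m, 'g) monoid_scheme \<Rightarrow> ('m, 'v::ab_group_add) monoid_rep \<Rightarrow> bool" where
  "irreducible_module G M \<longleftrightarrow>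
     monoid_module G M \<and> vspace M \<noteq> {0} \<and>
     (\<forall>U. invariant_subspace G M U \<longrightarrow> U = {0} \<or> U = vspace M)"

definition module_isomorphic ::
    "('m, 'g) monoid_scheme \<Rightarrow> ('m, 'v::ab_group_add) monoid_rep \<Rightarrow>
     ('m, 'w::ab_group_add) monoid_rep \<Rightarrow> bool" where
  "module_isomorphic G M N \<longleftrightarrow>
     (\<exists>\<phi>. bij_betw \<phi> (vspace M) (vspace N) \<and>
        (\<forall>x\<in>vspace M. \<forall>y\<in>vspace M. \<phi> (x + y) = \<phi> x + \<phi> y) \<and>
        (\<forall>c. \<forall>x\<in>vspace M. \<phi> (smul M c x) = smul N c (\<phi> x)) \<and>
        (\<forall>d\<in>carrier G. \<forall>x\<in>vspace M. \<phi> (act M d x) = act N d (\<phi> x)))"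

text \<open>The external direct sum of a family of modules living in the same ambient type.\<close>

definition direct_sum ::
    "'i set \<Rightarrow> ('i \<Rightarrow> ('m, 'v::ab_group_add) monoid_rep) \<Rightarrow> ('m, 'i \<Rightarrow> 'v) monoid_rep" where
  "direct_sum I M = \<lparr>
     vspace = {F. (\<forall>i\<in>I. F i \<in> vspace (M i)) \<and> (\<forall>i. i \<notin> I \<longrightarrow> F i = 0) \<and> finite {i. F i \<noteq> 0}},
     smul = (\<lambda>c F i. smul (M i) c (F i)),
     act = (\<lambda>d F i. if i \<in> I then act (M i) d (F i) else 0)\<rparr>"


section \<open>The planar rook monoid\<close>

text \<open>
  A diagram is the set of its edges; the pair \<open>(i, j)\<close> is the edge joining top vertex \<open>i\<close> to
  bottom vertex \<open>j\<close>. The set \<open>\<tau>(d)\<close> is \<open>Domain d\<close>, the set \<open>\<beta>(d)\<close> is \<open>Range d\<close>, and for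
  \<open>S \<subseteq> \<beta>(d)\<close> the set \<open>d(S)\<close> is the image \<open>d\<inverse> `` S\<close>.
\<close>

type_synonym diagram = "(nat \<times> nat) set"

definition rook_diagram :: "nat \<Rightarrow> diagram \<Rightarrow> bool" where
  "rook_diagram n d \<longleftrightarrow> d \<subseteq> {1..n} \<times> {1..n} \<and> single_valued d \<and> single_valued (d\<inverse>)"

text \<open>No two edges cross: the bijection from \<open>\<beta>(d)\<close> to \<open>\<tau>(d)\<close> is order-preserving.\<close>

definition planar :: "diagram \<Rightarrow> bool" where
  "planar d \<longleftrightarrow> (\<forall>(i, j)\<in>d. \<forall>(i', j')\<in>d. j < j' \<longrightarrow> i < i')"

definition planar_rook_monoid :: "nat \<Rightarrow> diagram monoid" where
  "planar_rook_monoid n = \<lparr>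
     carrier = {d. rook_diagram n d \<and> planar d},
     mult = (O),
     one = Id_on {1..n}\<rparr>"

lemma monoid_planar_rook_monoid: "monoid (planar_rook_monoid n)"
proof (rule monoidI)
  fix d e assume "d \<in> carrier (planar_rook_monoid n)" "e \<in> carrier (planar_rook_monoid n)"
  then have *: "rook_diagram n d" "rook_diagram n e" "planar d" "planar e"
    by (auto simp: planar_rook_monoid_def)
  then have "rook_diagram n (d O e)"
    by (auto simp: rook_diagram_def converse_relcomp intro: single_valued_relcomp)
  moreover have "planar (d O e)"
    using *(3,4) unfolding planar_def by fast
  ultimately show "d \<otimes>\<^bsub>planar_rook_monoid n\<^esub> e \<in> carrier (planar_rook_monoid n)"
    by (simp add: planar_rook_monoid_def)
qed (auto simp: planar_rook_monoid_def rook_diagram_def planar_def single_valued_def O_assoc)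


section \<open>The module \<open>V\<^sup>n\<close> and its submodules\<close>

text \<open>
  Vectors are complex-valued functions on sets of vertices; the basis vector \<open>v\<^sub>S\<close> is the indicator
  function of \<open>S\<close>, and the coordinate of \<open>f\<close> at \<open>v\<^sub>S\<close> is \<open>f S\<close>.
\<close>

type_synonym vec = "nat set \<Rightarrow> complex"

definition vec_smul :: "complex \<Rightarrow> vec \<Rightarrow> vec" where
  "vec_smul c f = (\<lambda>S. c * f S)"

definition basis_vec :: "nat set \<Rightarrow> vec" where
  "basis_vec S = (\<lambda>T. if T = S then 1 else 0)"

definition diagram_act_basis :: "diagram \<Rightarrow> nat set \<Rightarrow> vec" where
  "diagram_act_basis d S = (if S \<subseteq> Range d then basis_vec (d\<inverse> `` S) else 0)"

definition diagram_act :: "nat \<Rightarrow> diagram \<Rightarrow> vec \<Rightarrow> vec" where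
  "diagram_act n d f = (\<Sum>S\<in>Pow {1..n}. vec_smul (f S) (diagram_act_basis d S))"

definition V :: "nat \<Rightarrow> (diagram, vec) monoid_rep" where
  "V n = \<lparr>
     vspace = module.span vec_smul {basis_vec S | S. S \<subseteq> {1..n}},
     smul = vec_smul,
     act = diagram_act n\<rparr>"

definition V_sub :: "nat \<Rightarrow> nat \<Rightarrow> (diagram, vec) monoid_rep" where
  "V_sub n k = (V n)\<lparr>vspace := module.span vec_smul {basis_vec S | S. S \<subseteq> {1..n} \<and> card S = k}\<rparr>"

lemma vector_space_vec_smul: "vector_space vec_smul"
  by unfold_locales (auto simp: vec_smul_def fun_eq_iff algebra_simps)

lemma sum_vec_apply: "(\<Sum>x\<in>A. F x) T = (\<Sum>x\<in>A. (F x :: vec) T)"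
  by (induction A rule: infinite_finite_induct) auto

lemma basis_vec_unique:
  assumes "(\<Sum>S\<in>Pow {1..n}. vec_smul (c S) (basis_vec S)) = 0" and "S \<subseteq> {1..n::nat}"
  shows "c S = 0"
  using fun_cong[OF assms(1), of S] assms(2)
  by (simp add: sum_vec_apply vec_smul_def basis_vec_def if_distrib[of "\<lambda>x. _ * x"] cong: if_cong)

lemma diagram_act_basis_vec:
  assumes "S \<subseteq> {1..n}"
  shows "diagram_act n d (basis_vec S) = diagram_act_basis d S"
proof
  fix T
  have "diagram_act n d (basis_vec S) T
      = (\<Sum>S'\<in>Pow {1..n}. if S' = S then diagram_act_basis d S' T else 0)"
    unfolding diagram_act_def sum_vec_apply
    by (rule sum.cong) (auto simp: vec_smul_def basis_vec_def)
  also have "\<dots> = diagram_act_basis d S T"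
    using assms by simp
  finally show "diagram_act n d (basis_vec S) T = diagram_act_basis d S T" .
qed

end

theory Submission
  imports Defs
begin

text \<open>
  On coordinates the action is a precomposition: \<open>(d f) T\<close> is \<open>f (d `` T)\<close> if
  \<open>T \<subseteq> Domain d\<close> and \<open>0\<close> otherwise (\<open>diagram_act_apply\<close>). Since a diagram is injective,
  \<open>d `` T\<close> has as many elements as \<open>T\<close>, so the action preserves the decomposition of vectors
  by the size of the sets that carry their coordinates; this gives the submodules and the
  direct sum.

  Everything else comes from the idempotent diagrams \<open>Id_on S\<close>. On \<open>V_sub n k\<close> with
  \<open>k = card S\<close>, \<open>Id_on S\<close> is the projection onto the line of \<open>v\<^sub>S\<close>. Hence a nonzero invariant
  subspace contains some \<open>v\<^sub>S\<close>, and then every \<open>v\<^sub>T\<close>, because the order-preserving matching of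
  \<open>T\<close> with \<open>S\<close> carries \<open>v\<^sub>S\<close> to \<open>v\<^sub>T\<close>: this is irreducibility. On \<open>V_sub n k'\<close> with
  \<open>card S < k'\<close>, \<open>Id_on S\<close> acts as zero, which separates the modules for different sizes.

  For an arbitrary irreducible module \<open>M\<close>, choose \<open>S\<close> of the smallest size \<open>k\<close> such that
  \<open>Id_on S\<close> does not annihilate \<open>M\<close>, and a nonzero \<open>x\<close> in \<open>M\<close> that \<open>Id_on S\<close> fixes.
  Diagrams with fewer than \<open>k\<close> edges annihilate \<open>M\<close>, and a planar diagram is determined by its
  top and bottom vertex sets (\<open>planar_rook_diagram_eq_matching\<close>). Therefore sending \<open>v\<^sub>T\<close>, for
  \<open>T\<close> of size \<open>k\<close>, to the image of \<open>x\<close> under the matching of \<open>T\<close> with \<open>S\<close> is equivariant.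
  This homomorphism from \<open>V_sub n k\<close> to \<open>M\<close> is nonzero, so it is an isomorphism by Schur's
  lemma (\<open>irreducible_nonzero_homomorphism_isomorphic\<close>).
\<close>

section \<open>Homomorphisms of modules over a monoid\<close>

definition module_homomorphism ::
    "('m, 'g) monoid_scheme \<Rightarrow> ('m, 'v::ab_group_add) monoid_rep \<Rightarrow>
     ('m, 'w::ab_group_add) monoid_rep \<Rightarrow> ('v \<Rightarrow> 'w) \<Rightarrow> bool" where
  "module_homomorphism G M N \<phi> \<longleftrightarrow>
     (\<forall>x\<in>vspace M. \<phi> x \<in> vspace N) \<and>
     (\<forall>x\<in>vspace M. \<forall>y\<in>vspace M. \<phi> (x + y) = \<phi> x + \<phi> y) \<and>
     (\<forall>c. \<forall>x\<in>vspace M. \<phi> (smul M c x) = smul N c (\<phi> x)) \<and>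
     (\<forall>d\<in>carrier G. \<forall>x\<in>vspace M. \<phi> (act M d x) = act N d (\<phi> x))"

lemma module_isomorphic_iff_bij_homomorphism:
  "module_isomorphic G M N \<longleftrightarrow>
     (\<exists>\<phi>. bij_betw \<phi> (vspace M) (vspace N) \<and> module_homomorphism G M N \<phi>)"
  unfolding module_isomorphic_def module_homomorphism_def
  by (auto dest: bij_betwE)

lemma module_isomorphic_sym:
  assumes M: "monoid_module G M" and iso: "module_isomorphic G M N"
  shows "module_isomorphic G N M"
proof -
  interpret M: monoid_module G M by (rule M)
  obtain \<phi> where bij: "bij_betw \<phi> (vspace M) (vspace N)"
    and hom: "module_homomorphism G M N \<phi>"
    using iso unfolding module_isomorphic_iff_bij_homomorphism by blast
  define \<psi> where "\<psi> = inv_into (vspace M) \<phi>"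
  have \<psi>_bij: "bij_betw \<psi> (vspace N) (vspace M)"
    unfolding \<psi>_def by (rule bij_betw_inv_into[OF bij])
  have \<psi>_in: "\<psi> y \<in> vspace M" if "y \<in> vspace N" for y
    using \<psi>_bij that by (rule bij_betw_apply)
  have \<phi>\<psi>: "\<phi> (\<psi> y) = y" if "y \<in> vspace N" for y
    unfolding \<psi>_def using bij that by (rule bij_betw_inv_into_right)
  have \<psi>_eqI: "\<psi> y = x" if "x \<in> vspace M" "\<phi> x = y" for x y
    unfolding \<psi>_def using bij_betw_inv_into_left[OF bij that(1)] that(2) by simp
  have "module_homomorphism G N M \<psi>"
    unfolding module_homomorphism_def
  proof (intro conjI ballI allI)
    fix x y assume "x \<in> vspace N" "y \<in> vspace N"
    then show "\<psi> (x + y) = \<psi> x + \<psi> y"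
      using hom unfolding module_homomorphism_def
      by (intro \<psi>_eqI) (simp_all add: \<phi>\<psi> \<psi>_in M.subspace_add[OF M.subspace_vspace])
  next
    fix c x assume "x \<in> vspace N"
    then show "\<psi> (smul N c x) = smul M c (\<psi> x)"
      using hom unfolding module_homomorphism_def
      by (intro \<psi>_eqI) (simp_all add: \<phi>\<psi> \<psi>_in M.subspace_scale[OF M.subspace_vspace])
  next
    fix d x assume "d \<in> carrier G" "x \<in> vspace N"
    then show "\<psi> (act N d x) = act M d (\<psi> x)"
      using hom unfolding module_homomorphism_def
      by (intro \<psi>_eqI) (simp_all add: \<phi>\<psi> \<psi>_in M.act_closed)
  qed (rule \<psi>_in)
  with \<psi>_bij show ?thesis
    unfolding module_isomorphic_iff_bij_homomorphism by blast
qed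

lemma module_isomorphic_trans:
  assumes "module_isomorphic G L M" and "module_isomorphic G M N"
  shows "module_isomorphic G L N"
proof -
  obtain \<phi> where \<phi>: "bij_betw \<phi> (vspace L) (vspace M)" "module_homomorphism G L M \<phi>"
    using assms(1) unfolding module_isomorphic_iff_bij_homomorphism by blast
  obtain \<psi> where \<psi>: "bij_betw \<psi> (vspace M) (vspace N)" "module_homomorphism G M N \<psi>"
    using assms(2) unfolding module_isomorphic_iff_bij_homomorphism by blast
  have "module_homomorphism G L N (\<psi> \<circ> \<phi>)"
    using \<phi>(2) \<psi>(2) unfolding module_homomorphism_def by simp
  then show ?thesis
    using bij_betw_trans[OF \<phi>(1) \<psi>(1)]
    unfolding module_isomorphic_iff_bij_homomorphism by blast
qed

lemma (in monoid_module) act_zero: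
  assumes "d \<in> carrier G"
  shows "act M d 0 = 0"
  using act_smul[OF assms, of 0 0] subspace_0[OF subspace_vspace] by simp

lemma (in monoid_module) act_sum:
  assumes "d \<in> carrier G" and "\<And>i. i \<in> I \<Longrightarrow> f i \<in> vspace M"
  shows "act M d (\<Sum>i\<in>I. f i) = (\<Sum>i\<in>I. act M d (f i))"
  using assms(2)
proof (induction I rule: infinite_finite_induct)
  case (insert i I)
  then show ?case
    by (simp add: act_add[OF assms(1)] subspace_sum[OF subspace_vspace])
qed (simp_all add: act_zero assms(1))

lemma module_homomorphism_zero:
  assumes "monoid_module G M" and "monoid_module G N" and "module_homomorphism G M N \<phi>"
  shows "\<phi> 0 = 0"
proof -
  interpret M: monoid_module G M by (rule assms(1))
  interpret N: monoid_module G N by (rule assms(2))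
  have "\<phi> (smul M 0 0) = smul N 0 (\<phi> 0)"
    using assms(3) M.subspace_0[OF M.subspace_vspace] unfolding module_homomorphism_def by blast
  then show ?thesis by simp
qed

text \<open>
  Schur's lemma: the kernel and the image are invariant subspaces, the kernel is not the whole
  module and the image is not zero.
\<close>

lemma irreducible_nonzero_homomorphism_isomorphic:
  assumes irrM: "irreducible_module G M" and irrN: "irreducible_module G N"
    and hom: "module_homomorphism G M N \<phi>"
    and x: "x \<in> vspace M" "\<phi> x \<noteq> 0"
  shows "module_isomorphic G M N"
proof -
  have modules: "monoid_module G M" "monoid_module G N"
    using irrM irrN unfolding irreducible_module_def by auto
  interpret M: monoid_module G M by (rule modules)
  interpret N: monoid_module G N by (rule modules)
  note zero = module_homomorphism_zero[OF modules hom]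
  have \<phi>: "\<And>x. x \<in> vspace M \<Longrightarrow> \<phi> x \<in> vspace N"
    "\<And>x y. x \<in> vspace M \<Longrightarrow> y \<in> vspace M \<Longrightarrow> \<phi> (x + y) = \<phi> x + \<phi> y"
    "\<And>c x. x \<in> vspace M \<Longrightarrow> \<phi> (smul M c x) = smul N c (\<phi> x)"
    "\<And>d x. d \<in> carrier G \<Longrightarrow> x \<in> vspace M \<Longrightarrow> \<phi> (act M d x) = act N d (\<phi> x)"
    using hom unfolding module_homomorphism_def by auto
  note M_closed = M.subspace_0[OF M.subspace_vspace] M.subspace_add[OF M.subspace_vspace]
    M.subspace_scale[OF M.subspace_vspace] M.subspace_diff[OF M.subspace_vspace] M.act_closed
  have "invariant_subspace G M {y \<in> vspace M. \<phi> y = 0}"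
    unfolding invariant_subspace_def M.subspace_def
    by (auto simp: \<phi> zero M_closed N.act_zero)
  then have "{y \<in> vspace M. \<phi> y = 0} = {0} \<or> {y \<in> vspace M. \<phi> y = 0} = vspace M"
    using irrM unfolding irreducible_module_def by blast
  then have kernel: "y = 0" if "y \<in> vspace M" "\<phi> y = 0" for y
    using x that by blast
  have "inj_on \<phi> (vspace M)"
  proof (rule inj_onI)
    fix y z assume yz: "y \<in> vspace M" "z \<in> vspace M" "\<phi> y = \<phi> z"
    have "\<phi> ((y - z) + z) = \<phi> (y - z) + \<phi> z"
      using yz by (intro \<phi>(2) M_closed(4))
    then have "\<phi> (y - z) = 0"
      using yz(3) by simp
    then show "y = z"
      using kernel M_closed(4) yz by fastforce
  qed
  moreover have "invariant_subspace G N (\<phi> ` vspace M)"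
    unfolding invariant_subspace_def N.subspace_def
  proof (intro conjI ballI allI)
    show "0 \<in> \<phi> ` vspace M"
      using zero M_closed(1) by (metis imageI)
  qed (auto simp: \<phi> M_closed simp flip: \<phi>(2,3,4))
  then have "\<phi> ` vspace M = {0} \<or> \<phi> ` vspace M = vspace N"
    using irrN unfolding irreducible_module_def by blast
  with x have "\<phi> ` vspace M = vspace N" by blast
  ultimately show ?thesis
    using hom unfolding module_isomorphic_iff_bij_homomorphism bij_betw_def by blast
qed


section \<open>Planar rook diagrams\<close>

lemma Id_on_in_planar_rook_monoid:
  "S \<subseteq> {1..n} \<Longrightarrow> Id_on S \<in> carrier (planar_rook_monoid n)"
  by (auto simp: planar_rook_monoid_def rook_diagram_def planar_def single_valued_def)

lemma rook_diagram_card_Image: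
  assumes "rook_diagram n d" and "T \<subseteq> Domain d"
  shows "card (d `` T) = card T"
proof -
  have "bij_betw (\<lambda>i. THE j. (i, j) \<in> d) T (d `` T)"
  proof -
    have the: "(THE j. (i, j) \<in> d) = j" if "(i, j) \<in> d" for i j
      using assms(1) that by (auto simp: rook_diagram_def single_valued_def)
    show ?thesis
      unfolding bij_betw_def inj_on_def
    proof (intro conjI ballI impI)
      fix i i' assume "i \<in> T" "i' \<in> T" and eq: "(THE j. (i, j) \<in> d) = (THE j. (i', j) \<in> d)"
      then obtain j j' where "(i, j) \<in> d" "(i', j') \<in> d"
        using assms(2) by blast
      with eq the assms(1) show "i = i'"
        by (auto simp: rook_diagram_def single_valued_def)
    next
      show "(\<lambda>i. THE j. (i, j) \<in> d) ` T = d `` T"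
        using assms(2) the by force
    qed
  qed
  then show ?thesis by (simp add: bij_betw_same_card)
qed

lemma rook_diagram_inverse:
  "rook_diagram n d \<Longrightarrow> rook_diagram n (d\<inverse>)"
  by (auto simp: rook_diagram_def)

text \<open>
  At most one set of bottom vertices is carried by \<open>d\<close> to a given set of top vertices; this turns the sum that defines the
  action into a single term.
\<close>

lemma rook_diagram_Image_inverse_iff:
  assumes "rook_diagram n d"
  shows "S \<subseteq> Range d \<and> d\<inverse> `` S = T \<longleftrightarrow> T \<subseteq> Domain d \<and> S = d `` T"
  using assms unfolding rook_diagram_def single_valued_def by fast

definition vertex_rank :: "nat set \<Rightarrow> nat \<Rightarrow> nat" where
  "vertex_rank S i = card {s \<in> S. s < i}"

lemma vertex_rank_less:
  assumes "finite S" and "i \<in> S" and "i < j"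
  shows "vertex_rank S i < vertex_rank S j"
  unfolding vertex_rank_def using assms by (intro psubset_card_mono) auto

lemma vertex_rank_less_iff:
  assumes "finite S" and "i \<in> S" and "j \<in> S"
  shows "vertex_rank S i < vertex_rank S j \<longleftrightarrow> i < j"
  using vertex_rank_less[OF assms(1)] assms(2,3) by (metis linorder_cases less_asym less_irrefl)

lemma vertex_rank_inj_on: "finite S \<Longrightarrow> inj_on (vertex_rank S) S"
  by (rule inj_onI) (metis vertex_rank_less nat_neq_iff)

lemma vertex_rank_image:
  assumes "finite S"
  shows "vertex_rank S ` S = {..<card S}"
proof (rule card_subset_eq)
  show "vertex_rank S ` S \<subseteq> {..<card S}"
    using assms by (auto simp: vertex_rank_def intro!: psubset_card_mono)
  show "card (vertex_rank S ` S) = card {..<card S}"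
    using vertex_rank_inj_on[OF assms] by (simp add: card_image)
qed simp

text \<open>
  For sets of equal size this is the order-preserving bijection, drawn as a diagram; comparing
  ranks avoids a choice of enumerations of the two sets.
\<close>

definition planar_matching :: "nat set \<Rightarrow> nat set \<Rightarrow> diagram" where
  "planar_matching S T = {(i, j). i \<in> S \<and> j \<in> T \<and> vertex_rank S i = vertex_rank T j}"

lemma planar_matching_in_planar_rook_monoid:
  assumes "S \<subseteq> {1..n}" and "T \<subseteq> {1..n}"
  shows "planar_matching S T \<in> carrier (planar_rook_monoid n)"
proof -
  have fin: "finite S" "finite T"
    using assms finite_subset by blast+
  have "single_valued (planar_matching S T)" "single_valued ((planar_matching S T)\<inverse>)"
    using vertex_rank_inj_on[OF fin(1)] vertex_rank_inj_on[OF fin(2)]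
    unfolding single_valued_def planar_matching_def inj_on_def by simp_all
  moreover have "planar (planar_matching S T)"
    using vertex_rank_less_iff[OF fin(1)] vertex_rank_less_iff[OF fin(2)]
    unfolding planar_def planar_matching_def by fastforce
  moreover have "planar_matching S T \<subseteq> {1..n} \<times> {1..n}"
    using assms unfolding planar_matching_def by blast
  ultimately show ?thesis
    by (simp add: planar_rook_monoid_def rook_diagram_def)
qed

lemma Domain_planar_matching:
  assumes "finite S" and "finite T" and "card S = card T"
  shows "Domain (planar_matching S T) = S"
proof -
  have "vertex_rank S ` S = vertex_rank T ` T"
    using assms by (simp add: vertex_rank_image)
  then have "\<exists>j\<in>T. vertex_rank S i = vertex_rank T j" if "i \<in> S" for i
    using that by (metis imageE imageI)
  then show ?thesis unfolding planar_matching_def by blast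
qed

lemma planar_matching_converse: "(planar_matching S T)\<inverse> = planar_matching T S"
  unfolding planar_matching_def by auto

lemma Range_planar_matching:
  assumes "finite S" and "finite T" and "card S = card T"
  shows "Range (planar_matching S T) = T"
  using Domain_planar_matching[of T S] assms planar_matching_converse[of S T]
    Domain_converse[of "planar_matching S T"] by simp

text \<open>
  An edge of a planar diagram joins vertices of equal rank, because the edges to the left of it
  at the top are the edges to the left of it at the bottom. Conversely, ranks are injective, so
  two vertices of equal rank that both carry edges lie on the same edge.
\<close>

lemma planar_rook_diagram_eq_matching:
  assumes "d \<in> carrier (planar_rook_monoid n)"
  shows "d = planar_matching (Domain d) (Range d)"
proof -
  have d: "rook_diagram n d" "planar d"
    using assms by (auto simp: planar_rook_monoid_def)
  have fin: "finite (Domain d)" "finite (Range d)"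
    using d(1) unfolding rook_diagram_def
    by (meson finite_Domain finite_Range finite_SigmaI finite_atLeastAtMost finite_subset)+
  have less_iff: "i < i' \<longleftrightarrow> j < j'" if "(i, j) \<in> d" "(i', j') \<in> d" for i j i' j'
  proof -
    have less: "a < a'" if "(a, b) \<in> d" "(a', b') \<in> d" "b < b'" for a b a' b'
      using d(2) that unfolding planar_def by blast
    have "i = i'" if "j = j'"
      using d(1) \<open>(i, j) \<in> d\<close> \<open>(i', j') \<in> d\<close> that
      unfolding rook_diagram_def single_valued_def by blast
    then show ?thesis
      using less[OF that] less[OF that(2,1)] by (cases j j' rule: linorder_cases) auto
  qed
  have rank: "vertex_rank (Domain d) i = vertex_rank (Range d) j" if "(i, j) \<in> d" for i j
  proof -
    have "d `` {s \<in> Domain d. s < i} = {t \<in> Range d. t < j}"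
      using less_iff[OF _ that] by blast
    moreover have "card (d `` {s \<in> Domain d. s < i}) = card {s \<in> Domain d. s < i}"
      by (rule rook_diagram_card_Image[OF d(1)]) blast
    ultimately show ?thesis unfolding vertex_rank_def by simp
  qed
  have "(i, j) \<in> d" if "(i, j) \<in> planar_matching (Domain d) (Range d)" for i j
  proof -
    obtain j' where j': "(i, j') \<in> d"
      using \<open>(i, j) \<in> planar_matching (Domain d) (Range d)\<close> unfolding planar_matching_def by blast
    have "j \<in> Range d" "vertex_rank (Range d) j = vertex_rank (Range d) j'"
      using that rank[OF j'] unfolding planar_matching_def by auto
    then have "j = j'"
      using vertex_rank_inj_on[OF fin(2)] j' by (meson inj_onD Range.intros)
    with j' show ?thesis by simp
  qed
  moreover have "d \<subseteq> planar_matching (Domain d) (Range d)"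
    unfolding planar_matching_def using rank by blast
  ultimately show ?thesis by (intro equalityI subrelI) auto
qed


section \<open>The modules spanned by subsets\<close>

lemma span_basis_vec:
  assumes "finite A"
  shows "module.span vec_smul {basis_vec S | S. S \<in> A} = {f. \<forall>S. f S \<noteq> 0 \<longrightarrow> S \<in> A}"
proof -
  interpret vector_space vec_smul by (rule vector_space_vec_smul)
  show ?thesis
  proof (intro equalityI subsetI)
    fix f assume "f \<in> span {basis_vec S | S. S \<in> A}"
    then show "f \<in> {f. \<forall>S. f S \<noteq> 0 \<longrightarrow> S \<in> A}"
    proof (induction rule: span_induct)
      case base
      have "subspace {f. \<forall>S. f S \<noteq> 0 \<longrightarrow> S \<in> A}"
        unfolding subspace_def by (auto simp: vec_smul_def) (metis add.right_neutral)
      then show ?case by simp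
    qed (auto simp: basis_vec_def split: if_splits)
  next
    fix f :: vec assume f: "f \<in> {f. \<forall>S. f S \<noteq> 0 \<longrightarrow> S \<in> A}"
    have "f = (\<Sum>S\<in>A. vec_smul (f S) (basis_vec S))"
      using assms f
      by (auto simp: fun_eq_iff sum_vec_apply vec_smul_def basis_vec_def
          if_distrib[of "\<lambda>x. _ * x"] cong: if_cong)
    also have "\<dots> \<in> span {basis_vec S | S. S \<in> A}"
      by (intro span_sum span_scale span_base) blast
    finally show "f \<in> span {basis_vec S | S. S \<in> A}" .
  qed
qed

lemma vspace_V: "vspace (V n) = {f. \<forall>S. f S \<noteq> 0 \<longrightarrow> S \<subseteq> {1..n}}"
  using span_basis_vec[of "{S. S \<subseteq> {1..n}}"] by (simp add: V_def)

lemma vspace_V_sub: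
  "vspace (V_sub n k) = {f. \<forall>S. f S \<noteq> 0 \<longrightarrow> S \<subseteq> {1..n} \<and> card S = k}"
  using span_basis_vec[of "{S. S \<subseteq> {1..n} \<and> card S = k}"] by (simp add: V_sub_def)

lemma V_simps [simp]:
  "smul (V n) = vec_smul" "act (V n) = diagram_act n"
  "smul (V_sub n k) = vec_smul" "act (V_sub n k) = diagram_act n"
  by (simp_all add: V_def V_sub_def)

lemma diagram_act_apply:
  assumes "rook_diagram n d"
  shows "diagram_act n d f T = (if T \<subseteq> Domain d then f (d `` T) else 0)"
proof -
  have "d `` T \<subseteq> {1..n}"
    using assms unfolding rook_diagram_def by blast
  have "vec_smul (f S) (diagram_act_basis d S) T
      = (if S = d `` T then if T \<subseteq> Domain d then f S else 0 else 0)" for S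
    using rook_diagram_Image_inverse_iff[OF assms, of S T]
    by (auto simp: vec_smul_def diagram_act_basis_def basis_vec_def)
  then have "diagram_act n d f T
      = (\<Sum>S\<in>Pow {1..n}. if S = d `` T then if T \<subseteq> Domain d then f S else 0 else 0)"
    by (simp only: diagram_act_def sum_vec_apply)
  also have "\<dots> = (if T \<subseteq> Domain d then f (d `` T) else 0)"
    using \<open>d `` T \<subseteq> {1..n}\<close> by simp
  finally show ?thesis .
qed

lemma monoid_module_V: "monoid_module (planar_rook_monoid n) (V n)"
proof -
  interpret monoid "planar_rook_monoid n" by (rule monoid_planar_rook_monoid)
  interpret vector_space vec_smul by (rule vector_space_vec_smul)
  have rook: "rook_diagram n d" if "d \<in> carrier (planar_rook_monoid n)" for d
    using that by (simp add: planar_rook_monoid_def)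
  have Domain: "T \<subseteq> {1..n}" if "rook_diagram n d" "T \<subseteq> Domain d" for d T
    using that unfolding rook_diagram_def by blast
  show ?thesis
  proof (intro monoid_module.intro monoid_module_axioms.intro)
    show "monoid (planar_rook_monoid n)" ..
    show "vector_space (smul (V n))" by (simp add: vector_space_vec_smul)
    show "module.subspace (smul (V n)) (vspace (V n))"
      unfolding V_simps by (simp add: V_def)
  next
    fix d e :: diagram and x y :: vec and c
    assume d: "d \<in> carrier (planar_rook_monoid n)"
    show "act (V n) d (x + y) = act (V n) d x + act (V n) d y"
      by (simp add: fun_eq_iff diagram_act_apply rook d)
    show "act (V n) d (smul (V n) c x) = smul (V n) c (act (V n) d x)"
      by (simp add: fun_eq_iff diagram_act_apply rook d vec_smul_def)
    assume "x \<in> vspace (V n)"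
    show "act (V n) d x \<in> vspace (V n)"
      using Domain rook[OF d] by (auto simp: vspace_V diagram_act_apply split: if_splits)
    assume e: "e \<in> carrier (planar_rook_monoid n)"
    have "d O e \<in> carrier (planar_rook_monoid n)"
      using m_closed[OF d e] by (simp add: planar_rook_monoid_def)
    note de = diagram_act_apply[OF rook[OF this]]
    have Domain_comp: "T \<subseteq> Domain (d O e) \<longleftrightarrow> T \<subseteq> Domain d \<and> d `` T \<subseteq> Domain e" for T
    proof
      assume T: "T \<subseteq> Domain (d O e)"
      have "j \<in> Domain e" if i: "i \<in> T" and ij: "(i, j) \<in> d" for i j
      proof -
        obtain j' where "(i, j') \<in> d" "j' \<in> Domain e"
          using T i by fast
        with ij rook[OF d] show ?thesis
          unfolding rook_diagram_def single_valued_def by metis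
      qed
      with T show "T \<subseteq> Domain d \<and> d `` T \<subseteq> Domain e" by blast
    qed blast
    have "diagram_act n (d O e) x = diagram_act n d (diagram_act n e x)"
      by (rule ext) (simp only: de diagram_act_apply[OF rook[OF d]]
          diagram_act_apply[OF rook[OF e]] Domain_comp relcomp_Image if_if_eq_conj)
    then show "act (V n) (d \<otimes>\<^bsub>planar_rook_monoid n\<^esub> e) x = act (V n) d (act (V n) e x)"
      by (simp add: planar_rook_monoid_def)
  next
    fix x assume x: "x \<in> vspace (V n)"
    have "rook_diagram n (Id_on {1..n})"
      using rook[OF one_closed] by (simp add: planar_rook_monoid_def)
    moreover have "Id_on {1..n} `` T = T" if "T \<subseteq> {1..n}" for T
      using that by auto
    moreover have "x T = 0" if "\<not> T \<subseteq> {1..n}" for T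
      using x that unfolding vspace_V by blast
    ultimately have "diagram_act n (Id_on {1..n}) x = x"
      by (simp add: fun_eq_iff diagram_act_apply)
    then show "act (V n) \<one>\<^bsub>planar_rook_monoid n\<^esub> x = x"
      by (simp add: planar_rook_monoid_def)
  qed
qed

lemma monoid_module_invariant_subspace:
  assumes M: "monoid_module G M" and U: "invariant_subspace G M U"
  shows "monoid_module G (M\<lparr>vspace := U\<rparr>)"
proof -
  interpret M: monoid_module G M by (rule M)
  show ?thesis
    using U M.monoid_axioms M.vector_space_axioms
    unfolding invariant_subspace_def
    by (auto intro!: monoid_module.intro monoid_module_axioms.intro
        simp: M.act_add M.act_smul M.act_mult M.act_one subset_iff)
qed

lemma invariant_subspace_V_sub:
  "invariant_subspace (planar_rook_monoid n) (V n) (vspace (V_sub n k))"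
proof -
  interpret vector_space vec_smul by (rule vector_space_vec_smul)
  have "diagram_act n d f \<in> vspace (V_sub n k)"
    if "d \<in> carrier (planar_rook_monoid n)" "f \<in> vspace (V_sub n k)" for d f
  proof -
    have d: "rook_diagram n d"
      using that by (simp add: planar_rook_monoid_def)
    then have "Domain d \<subseteq> {1..n}"
      unfolding rook_diagram_def by blast
    with that(2) d show ?thesis
      by (auto simp: vspace_V_sub diagram_act_apply rook_diagram_card_Image split: if_splits)
  qed
  moreover have "subspace (vspace (V_sub n k))"
    by (simp add: V_sub_def)
  moreover have "vspace (V_sub n k) \<subseteq> vspace (V n)"
    by (auto simp: vspace_V vspace_V_sub)
  ultimately show ?thesis
    unfolding invariant_subspace_def by simp
qed

lemma monoid_module_V_sub: "monoid_module (planar_rook_monoid n) (V_sub n k)"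
proof -
  have "V_sub n k = (V n)\<lparr>vspace := vspace (V_sub n k)\<rparr>"
    by (simp add: V_sub_def)
  then show ?thesis
    using monoid_module_invariant_subspace[OF monoid_module_V invariant_subspace_V_sub] by metis
qed

lemma basis_vec_in_V_sub:
  "basis_vec S \<in> vspace (V_sub n k) \<longleftrightarrow> S \<subseteq> {1..n} \<and> card S = k"
  by (auto simp: vspace_V_sub basis_vec_def)

lemma basis_vec_nonzero: "basis_vec S \<noteq> 0"
  by (auto simp: basis_vec_def fun_eq_iff)

text \<open>
  A subset of \<open>S\<close> with as many elements as \<open>S\<close> is \<open>S\<close> itself, so a single coordinate survives.
\<close>

lemma Id_on_act_V_sub:
  assumes "f \<in> vspace (V_sub n k)" and "S \<subseteq> {1..n}" and "card S = k"
  shows "diagram_act n (Id_on S) f = vec_smul (f S) (basis_vec S)"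
proof
  fix T
  have fin: "finite S" using assms(2) finite_subset by blast
  have "rook_diagram n (Id_on S)"
    using Id_on_in_planar_rook_monoid[OF assms(2)] by (simp add: planar_rook_monoid_def)
  moreover have "f T = 0" if "T \<subseteq> S" "T \<noteq> S"
  proof -
    have "card T \<noteq> k"
      using psubset_card_mono[OF fin, of T] that assms(3) by (metis less_irrefl psubsetI)
    then show ?thesis using assms(1) unfolding vspace_V_sub by blast
  qed
  moreover have "Id_on S `` T = T" if "T \<subseteq> S"
    using that by auto
  ultimately show "diagram_act n (Id_on S) f T = vec_smul (f S) (basis_vec S) T"
    by (auto simp: diagram_act_apply vec_smul_def basis_vec_def)
qed

lemma Id_on_act_V_sub_zero:
  assumes "f \<in> vspace (V_sub n k)" and "S \<subseteq> {1..n}" and "card S < k"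
  shows "diagram_act n (Id_on S) f = 0"
proof
  fix T
  have fin: "finite S" using assms(2) finite_subset by blast
  have "rook_diagram n (Id_on S)"
    using Id_on_in_planar_rook_monoid[OF assms(2)] by (simp add: planar_rook_monoid_def)
  moreover have "f (Id_on S `` T) = 0"
    using assms card_mono[OF fin, of "Id_on S `` T"] by (force simp: vspace_V_sub)
  ultimately show "diagram_act n (Id_on S) f T = 0 T"
    by (simp add: diagram_act_apply)
qed

text \<open>
  A nonzero vector has a nonzero coordinate at some \<open>S\<close>, so the projection \<open>Id_on S\<close> extracts
  a basis vector from it; the matchings carry this basis vector to all others.
\<close>

lemma irreducible_V_sub:
  assumes "k \<le> n"
  shows "irreducible_module (planar_rook_monoid n) (V_sub n k)"
  unfolding irreducible_module_def
proof (intro conjI allI impI monoid_module_V_sub)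
  have "basis_vec {1..k} \<in> vspace (V_sub n k)"
    using assms by (simp add: basis_vec_in_V_sub)
  then show "vspace (V_sub n k) \<noteq> {0}"
    using basis_vec_nonzero by blast
next
  interpret vector_space vec_smul by (rule vector_space_vec_smul)
  fix U assume "invariant_subspace (planar_rook_monoid n) (V_sub n k) U"
  then have U: "U \<subseteq> vspace (V_sub n k)" "subspace U"
    "\<And>d f. d \<in> carrier (planar_rook_monoid n) \<Longrightarrow> f \<in> U \<Longrightarrow> diagram_act n d f \<in> U"
    unfolding invariant_subspace_def by auto
  show "U = {0} \<or> U = vspace (V_sub n k)"
  proof (cases "U = {0}")
    case False
    then obtain f where f: "f \<in> U" "f \<noteq> 0"
      using subspace_0[OF U(2)] by blast
    then obtain S where fS: "f S \<noteq> 0" by (auto simp: fun_eq_iff)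
    then have S: "S \<subseteq> {1..n}" "card S = k"
      using f U(1) unfolding vspace_V_sub by blast+
    have "vec_smul (inverse (f S)) (diagram_act n (Id_on S) f) \<in> U"
      using U f(1) Id_on_in_planar_rook_monoid[OF S(1)] by (simp add: subspace_scale)
    moreover have "vec_smul (inverse (f S)) (diagram_act n (Id_on S) f) = basis_vec S"
      using Id_on_act_V_sub[OF _ S] f(1) U(1) fS by (auto simp: vec_smul_def fun_eq_iff)
    ultimately have vS: "basis_vec S \<in> U" by simp
    have "basis_vec T \<in> U" if T: "T \<subseteq> {1..n}" "card T = k" for T
    proof -
      have fin: "finite S" "finite T" using S T finite_subset by blast+
      let ?d = "planar_matching T S"
      have d: "?d \<in> carrier (planar_rook_monoid n)"
        using S T by (simp add: planar_matching_in_planar_rook_monoid)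
      have "diagram_act n ?d (basis_vec S) = basis_vec (?d\<inverse> `` S)"
        using S T fin by (simp add: diagram_act_basis_vec diagram_act_basis_def Range_planar_matching)
      also have "?d\<inverse> `` S = T"
      proof -
        have "Domain ?d = T" "Range ?d = S"
          using Domain_planar_matching[OF fin(2,1)] Range_planar_matching[OF fin(2,1)] S T by simp_all
        then show ?thesis by blast
      qed
      finally show ?thesis using U(3)[OF d vS] by simp
    qed
    then have "span {basis_vec T | T. T \<subseteq> {1..n} \<and> card T = k} \<subseteq> U"
      by (intro span_minimal U(2)) blast
    then have "vspace (V_sub n k) \<subseteq> U" by (simp add: V_sub_def)
    with U(1) show ?thesis by blast
  qed simp
qed

text \<open>
  For \<open>k < k'\<close> the idempotent on \<open>{1..k}\<close> fixes a nonzero vector of \<open>V_sub n k\<close> but annihilates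
  \<open>V_sub n k'\<close>.
\<close>

lemma V_sub_isomorphic_imp_le:
  assumes "k \<le> n" and "module_isomorphic (planar_rook_monoid n) (V_sub n k) (V_sub n k')"
  shows "k' \<le> k"
proof (rule ccontr)
  assume "\<not> k' \<le> k"
  obtain \<phi> where bij: "bij_betw \<phi> (vspace (V_sub n k)) (vspace (V_sub n k'))"
    and hom: "module_homomorphism (planar_rook_monoid n) (V_sub n k) (V_sub n k') \<phi>"
    using assms(2) unfolding module_isomorphic_iff_bij_homomorphism by blast
  let ?v = "basis_vec {1..k}" and ?e = "Id_on {1..k}"
  have sub: "{1..k} \<subseteq> {1..n}" using assms(1) by auto
  then have v: "?v \<in> vspace (V_sub n k)" by (simp add: basis_vec_in_V_sub)
  have "\<phi> (diagram_act n ?e ?v) = diagram_act n ?e (\<phi> ?v)"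
    using hom v Id_on_in_planar_rook_monoid[OF sub] unfolding module_homomorphism_def by simp
  also have "diagram_act n ?e ?v = ?v"
    using Id_on_act_V_sub[OF v sub] by (simp add: vec_smul_def basis_vec_def)
  also have "diagram_act n ?e (\<phi> ?v) = 0"
    using Id_on_act_V_sub_zero[OF bij_betw_apply[OF bij v] sub] \<open>\<not> k' \<le> k\<close> by simp
  also have "0 = \<phi> 0"
    using module_homomorphism_zero[OF monoid_module_V_sub monoid_module_V_sub hom] by simp
  finally have "\<phi> ?v = \<phi> 0" .
  moreover have "0 \<in> vspace (V_sub n k)" by (simp add: vspace_V_sub)
  ultimately show False
    using bij v basis_vec_nonzero unfolding bij_betw_def inj_on_def by blast
qed

lemma V_sub_isomorphic_imp_eq:
  assumes "k \<le> n" and "k' \<le> n"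
    and "module_isomorphic (planar_rook_monoid n) (V_sub n k) (V_sub n k')"
  shows "k = k'"
  using V_sub_isomorphic_imp_le[OF assms(2) module_isomorphic_sym[OF monoid_module_V_sub assms(3)]]
    V_sub_isomorphic_imp_le[OF assms(1,3)] by simp

lemma V_isomorphic_direct_sum:
  "module_isomorphic (planar_rook_monoid n) (V n) (direct_sum {0..n} (V_sub n))"
proof -
  \<comment> \<open>The component of index \<open>k\<close> is the restriction to sets of size \<open>k\<close>; the inverse reads
    the coordinate at \<open>S\<close> off the component of index \<open>card S\<close>.\<close>
  define \<phi> :: "vec \<Rightarrow> nat \<Rightarrow> vec" where "\<phi> f = (\<lambda>k S. if k \<le> n \<and> card S = k then f S else 0)" for f
  have card_le: "card S \<le> n" if "S \<subseteq> {1..n}" for S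
    using card_mono[OF _ that] by simp
  have vspace_sum: "vspace (direct_sum {0..n} (V_sub n)) =
      {F. \<forall>k S. F k S \<noteq> 0 \<longrightarrow> k \<le> n \<and> S \<subseteq> {1..n} \<and> card S = k}" (is "_ = ?W")
  proof (intro equalityI subsetI)
    fix F assume "F \<in> ?W"
    then have F: "F k S = 0" if "\<not> (k \<le> n \<and> S \<subseteq> {1..n} \<and> card S = k)" for k S
      using that by blast
    then have "{k. F k \<noteq> 0} \<subseteq> {0..n}"
      by (fastforce simp: fun_eq_iff)
    then have "finite {k. F k \<noteq> 0}"
      by (rule finite_subset) simp
    with F show "F \<in> vspace (direct_sum {0..n} (V_sub n))"
      by (force simp: direct_sum_def vspace_V_sub fun_eq_iff)
  next
    fix F assume "F \<in> vspace (direct_sum {0..n} (V_sub n))"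
    then show "F \<in> ?W"
      by (force simp: direct_sum_def vspace_V_sub fun_eq_iff)
  qed
  have "bij_betw \<phi> (vspace (V n)) (vspace (direct_sum {0..n} (V_sub n)))"
  proof (rule bij_betwI[where g = "\<lambda>F S. F (card S) S"])
    show "\<phi> \<in> vspace (V n) \<rightarrow> vspace (direct_sum {0..n} (V_sub n))"
      by (auto simp: \<phi>_def vspace_V vspace_sum split: if_splits)
    show "(\<lambda>F S. F (card S) S) \<in> vspace (direct_sum {0..n} (V_sub n)) \<rightarrow> vspace (V n)"
      by (auto simp: vspace_V vspace_sum)
    show "(\<lambda>S. \<phi> f (card S) S) = f" if "f \<in> vspace (V n)" for f
      using that card_le by (fastforce simp: \<phi>_def vspace_V fun_eq_iff)
    show "\<phi> (\<lambda>S. F (card S) S) = F" if "F \<in> vspace (direct_sum {0..n} (V_sub n))" for F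
      using that by (fastforce simp: \<phi>_def vspace_sum fun_eq_iff)
  qed
  moreover have "\<phi> (diagram_act n d f) = act (direct_sum {0..n} (V_sub n)) d (\<phi> f)"
    if "d \<in> carrier (planar_rook_monoid n)" for d f
  proof -
    have "rook_diagram n d"
      using that by (simp add: planar_rook_monoid_def)
    then show ?thesis
      by (auto simp: \<phi>_def direct_sum_def fun_eq_iff diagram_act_apply rook_diagram_card_Image)
  qed
  moreover have "\<phi> (f + g) = \<phi> f + \<phi> g" for f g
    by (simp add: \<phi>_def fun_eq_iff)
  moreover have "\<phi> (vec_smul c f) = smul (direct_sum {0..n} (V_sub n)) c (\<phi> f)" for c f
    by (simp add: \<phi>_def direct_sum_def vec_smul_def fun_eq_iff)
  ultimately show ?thesis
    unfolding module_isomorphic_def by auto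
qed


section \<open>Classification of the irreducible modules\<close>

text \<open>
  The vectors \<open>b T\<close> in the proof play the part of the basis vectors \<open>v\<^sub>T\<close>. They satisfy the
  same relations: if \<open>T \<subseteq> Range d\<close>, the product of \<open>d\<close> with the matching of \<open>T\<close> and \<open>S\<close> is
  again a matching with \<open>S\<close>; otherwise it loses an edge and annihilates \<open>M\<close> by the minimality
  of \<open>S\<close>.
\<close>

lemma irreducible_isomorphic_V_sub:
  assumes irr: "irreducible_module (planar_rook_monoid n) M"
  obtains k where "k \<le> n" "module_isomorphic (planar_rook_monoid n) (V_sub n k) M"
proof -
  let ?P = "planar_rook_monoid n"
  interpret M: monoid_module ?P M
    using irr unfolding irreducible_module_def by blast
  define nonzero where
    "nonzero S \<longleftrightarrow> S \<subseteq> {1..n} \<and> (\<exists>y\<in>vspace M. act M (Id_on S) y \<noteq> 0)" for S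
  have mult: "d \<otimes>\<^bsub>?P\<^esub> e = d O e" for d e
    by (simp add: planar_rook_monoid_def)
  have rook: "rook_diagram n d" if "d \<in> carrier ?P" for d
    using that by (simp add: planar_rook_monoid_def)
  obtain y where "y \<in> vspace M" "y \<noteq> 0"
    using irr M.subspace_0[OF M.subspace_vspace] unfolding irreducible_module_def by blast
  then have "nonzero {1..n}"
    using M.act_one unfolding nonzero_def by (force simp: planar_rook_monoid_def)
  then obtain S where S: "nonzero S" and least: "\<And>R. nonzero R \<Longrightarrow> card S \<le> card R"
    using ex_has_least_nat[of nonzero _ card] by blast
  define k where "k = card S"
  have S_sub: "S \<subseteq> {1..n}" using S by (simp add: nonzero_def)
  then have S_fin: "finite S" and "k \<le> n"
    using finite_subset card_mono[of "{1..n}" S] by (auto simp: k_def)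
  obtain y where y: "y \<in> vspace M" "act M (Id_on S) y \<noteq> 0"
    using S unfolding nonzero_def by blast
  define x where "x = act M (Id_on S) y"
  have Id_S: "Id_on S \<in> carrier ?P" by (rule Id_on_in_planar_rook_monoid[OF S_sub])
  have x: "x \<in> vspace M" "x \<noteq> 0"
    using y Id_S by (simp_all add: x_def M.act_closed)
  have Id_x: "act M (Id_on S) x = x"
  proof -
    have "Id_on S O Id_on S = Id_on S" by auto
    then show ?thesis
      using M.act_mult[OF Id_S Id_S y(1)] by (simp add: x_def mult)
  qed
  \<comment> \<open>Such a diagram factors through the idempotent on its bottom vertices, which is zero on
    \<open>M\<close> by minimality.\<close>
  have small: "act M e z = 0"
    if e: "e \<in> carrier ?P" and "card (Range e) < k" and z: "z \<in> vspace M" for e z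
  proof -
    have Range: "Range e \<subseteq> {1..n}"
      using rook[OF e] unfolding rook_diagram_def by blast
    have "e O Id_on (Range e) = e" by auto
    then have "act M e z = act M e (act M (Id_on (Range e)) z)"
      using M.act_mult[OF e Id_on_in_planar_rook_monoid[OF Range] z] by (simp add: mult)
    also have "act M (Id_on (Range e)) z = 0"
      using least[of "Range e"] that Range unfolding nonzero_def k_def by force
    finally show ?thesis using e by (simp add: M.act_zero)
  qed
  define b where "b T = act M (planar_matching T S) x" for T
  have matching: "planar_matching T S \<in> carrier ?P" if "T \<subseteq> {1..n}" for T
    using that S_sub by (rule planar_matching_in_planar_rook_monoid)
  have b_in: "b T \<in> vspace M" if "T \<subseteq> {1..n}" for T
    unfolding b_def using x(1) matching[OF that] by (rule M.act_closed[rotated])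
  have act_b: "act M d (b T) = (if T \<subseteq> Range d then b (d\<inverse> `` T) else 0)"
    if d: "d \<in> carrier ?P" and T: "T \<subseteq> {1..n}" "card T = k" for d T
  proof -
    let ?m = "planar_matching T S" and ?e = "d O planar_matching T S"
    have fin: "finite T" using T finite_subset by blast
    have DR: "Domain ?m = T" "Range ?m = S"
      using Domain_planar_matching[OF fin S_fin] Range_planar_matching[OF fin S_fin] T
      by (simp_all add: k_def)
    have e: "?e \<in> carrier ?P"
      using M.m_closed[OF d matching[OF T(1)]] by (simp add: mult)
    have act_e: "act M d (b T) = act M ?e x"
      using M.act_mult[OF d matching[OF T(1)] x(1)] by (simp add: mult b_def)
    show ?thesis
    proof (cases "T \<subseteq> Range d")
      case True
      have "Domain ?e = d\<inverse> `` T" "Range ?e = S"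
        using True DR by blast+
      then have "?e = planar_matching (d\<inverse> `` T) S"
        using planar_rook_diagram_eq_matching[OF e] by simp
      then show ?thesis using True act_e by (simp add: b_def)
    next
      case False
      have "Range ?e = ?m `` (Range d \<inter> T)"
        using DR by blast
      then have "card (Range ?e) = card (Range d \<inter> T)"
        using rook_diagram_card_Image[OF rook[OF matching[OF T(1)]], of "Range d \<inter> T"] DR by simp
      also have "\<dots> < card T"
        using False fin by (intro psubset_card_mono) auto
      finally show ?thesis
        using False act_e small[OF e _ x(1)] T(2) by simp
    qed
  qed
  define A where "A = {T. T \<subseteq> {1..n} \<and> card T = k}"
  have A_fin: "finite A" by (simp add: A_def)
  define \<phi> where "\<phi> f = (\<Sum>T\<in>A. smul M (f T) (b T))" for f :: vec
  note M_closed = M.subspace_scale[OF M.subspace_vspace]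
  have \<phi>_in: "\<phi> f \<in> vspace M" for f
    unfolding \<phi>_def using b_in
    by (intro M.subspace_sum[OF M.subspace_vspace] M_closed) (simp add: A_def)
  have act_\<phi>: "\<phi> (diagram_act n d f) = act M d (\<phi> f)" if d: "d \<in> carrier ?P" for d f
  proof -
    have sub: "d \<subseteq> {1..n} \<times> {1..n}"
      using rook[OF d] unfolding rook_diagram_def by blast
    note iff = rook_diagram_Image_inverse_iff[OF rook[OF d]]
    have "\<phi> (diagram_act n d f) = (\<Sum>T\<in>A. if T \<subseteq> Domain d then smul M (f (d `` T)) (b T) else 0)"
      unfolding \<phi>_def by (intro sum.cong) (auto simp: diagram_act_apply rook[OF d])
    also have "\<dots> = (\<Sum>T\<in>{T \<in> A. T \<subseteq> Domain d}. smul M (f (d `` T)) (b T))"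
      using A_fin by (simp add: sum.inter_filter)
    also have "\<dots> = (\<Sum>T\<in>{T \<in> A. T \<subseteq> Range d}. smul M (f T) (b (d\<inverse> `` T)))"
    proof (rule sum.reindex_bij_witness[where i = "\<lambda>T. d\<inverse> `` T" and j = "\<lambda>T. d `` T"])
      fix T assume T: "T \<in> {T \<in> A. T \<subseteq> Domain d}"
      then show "d\<inverse> `` (d `` T) = T" using iff[of "d `` T" T] by simp
      then show "smul M (f (d `` T)) (b (d\<inverse> `` (d `` T))) = smul M (f (d `` T)) (b T)" by simp
      show "d `` T \<in> {T \<in> A. T \<subseteq> Range d}"
        using T rook_diagram_card_Image[OF rook[OF d], of T] sub by (auto simp: A_def)
    next
      fix T assume T: "T \<in> {T \<in> A. T \<subseteq> Range d}"
      then show "d `` (d\<inverse> `` T) = T" using iff[of T "d\<inverse> `` T"] by auto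
      show "d\<inverse> `` T \<in> {T \<in> A. T \<subseteq> Domain d}"
        using T rook_diagram_card_Image[OF rook_diagram_inverse[OF rook[OF d]], of T] sub
        by (auto simp: A_def)
    qed
    also have "\<dots> = (\<Sum>T\<in>A. if T \<subseteq> Range d then smul M (f T) (b (d\<inverse> `` T)) else 0)"
      using A_fin by (simp add: sum.inter_filter)
    also have "\<dots> = (\<Sum>T\<in>A. act M d (smul M (f T) (b T)))"
      by (intro sum.cong) (auto simp: A_def M.act_smul d b_in act_b)
    also have "\<dots> = act M d (\<phi> f)"
      unfolding \<phi>_def using d b_in by (intro M.act_sum[symmetric] M_closed) (auto simp: A_def)
    finally show ?thesis .
  qed
  have "module_homomorphism ?P (V_sub n k) M \<phi>"
    unfolding module_homomorphism_def
    by (auto simp: \<phi>_in act_\<phi>)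
      (simp_all add: \<phi>_def vec_smul_def M.scale_left_distrib sum.distrib M.scale_sum_right)
  moreover have "\<phi> (basis_vec S) = x"
  proof -
    have "S \<in> A" using S_sub by (simp add: A_def k_def)
    have "\<phi> (basis_vec S) = (\<Sum>T\<in>A. if T = S then b T else 0)"
      unfolding \<phi>_def by (intro sum.cong) (auto simp: basis_vec_def)
    also have "\<dots> = b S"
      using A_fin \<open>S \<in> A\<close> by simp
    also have "planar_matching S S = Id_on S"
      using planar_rook_diagram_eq_matching[OF Id_S] by simp
    then have "b S = x"
      using Id_x by (simp add: b_def)
    finally show ?thesis .
  qed
  moreover have "basis_vec S \<in> vspace (V_sub n k)"
    using S_sub by (simp add: basis_vec_in_V_sub k_def)
  ultimately have "module_isomorphic ?P (V_sub n k) M"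
    using irreducible_nonzero_homomorphism_isomorphic[OF irreducible_V_sub[OF \<open>k \<le> n\<close>] irr] x(2)
    by metis
  with \<open>k \<le> n\<close> show thesis by (rule that)
qed


section \<open>The decomposition theorem\<close>

theorem theorem2p1:
  fixes n :: nat
  shows
    "(monoid_module (planar_rook_monoid n) (V n) \<and>
      (\<forall>k\<le>n. monoid_module (planar_rook_monoid n) (V_sub n k) \<and>
             invariant_subspace (planar_rook_monoid n) (V n) (vspace (V_sub n k))) \<and>
      (\<forall>k\<le>n. \<forall>k'\<le>n. k \<noteq> k' \<longrightarrow>
         \<not> module_isomorphic (planar_rook_monoid n) (V_sub n k) (V_sub n k'))) \<and>
     (\<forall>k\<le>n. irreducible_module (planar_rook_monoid n) (V_sub n k)) \<and>
     module_isomorphic (planar_rook_monoid n) (V n) (direct_sum {0..n} (V_sub n)) \<and>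
     (\<forall>M :: (diagram, 'w::ab_group_add) monoid_rep.
        irreducible_module (planar_rook_monoid n) M \<longrightarrow>
        (\<exists>!k. k \<le> n \<and> module_isomorphic (planar_rook_monoid n) M (V_sub n k)))"
proof (intro conjI allI impI)
  fix M :: "(diagram, 'w) monoid_rep"
  assume irr: "irreducible_module (planar_rook_monoid n) M"
  obtain k where k: "k \<le> n" "module_isomorphic (planar_rook_monoid n) (V_sub n k) M"
    using irreducible_isomorphic_V_sub[OF irr] .
  show "\<exists>!k. k \<le> n \<and> module_isomorphic (planar_rook_monoid n) M (V_sub n k)"
  proof (rule ex1I[of _ k])
    show "k \<le> n \<and> module_isomorphic (planar_rook_monoid n) M (V_sub n k)"
      using k module_isomorphic_sym[OF monoid_module_V_sub] by blast
    show "k' = k" if "k' \<le> n \<and> module_isomorphic (planar_rook_monoid n) M (V_sub n k')" for k'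
      using V_sub_isomorphic_imp_eq[OF k(1)] module_isomorphic_trans[OF k(2)] that by blast
  qed
qed (auto simp: monoid_module_V monoid_module_V_sub invariant_subspace_V_sub irreducible_V_sub
    V_isomorphic_direct_sum dest: V_sub_isomorphic_imp_eq)

end
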